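(* Let $a>0$ and $p\in\mathbb{R}$ be fixed constants and let $\Pi=(0,1)\times(0,\infty)$. For every $\gamma>0$ there exist $\varepsilon>0$ and $M=M(\gamma)$ such that the following holds. Let $c:\overline{\Pi}\to\mathbb{R}$ be a twice continuously differentiable function such that $c$ and its first and second order partial derivatives are bounded on $\overline{\Pi}$, and suppose $\sup_{(x,t)\in\Pi}|c(x,t)|<\varepsilon$. Let $w_0\in H^1(0,1)$ and $w_1\in L^2(0,1)$. Then the $L^2$-generalized solution $w$ of the initial-boundary value problem $$w_{tt}-a^2w_{xx}+c(x,t)w=0,\quad (x,t)\in\Pi,$$ $$w(0,t)=p\,(w_t+aw_x)(0,t),\qquad (w_t+aw_x)(1,t)=0,\quad t\in(0,\infty),$$ $$w(x,0)=w_0(x),\qquad w_t(x,0)=w_1(x),\quad x\in[0,1],$$ satisfies $$\|w(\cdot,t)\|_{L^2(0,1)}\le M e^{-\gamma t}\max\left(\|w_0\|_{H^1(0,1)},\|w_1\|_{L^2(0,1)}\right)\quad\text{for all } t>0.$$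
   Context: $H^1(0,1)$ is the space of functions $u\in L^2(0,1)$ with weak derivative $u'\in L^2(0,1)$. Definition of the $L^2$-generalized solution. With $u=\partial_t w+a\,\partial_x w$, the wave problem is rewritten as the first order problem $$\partial_t w+a\,\partial_x w-u=0,\qquad \partial_t u-a\,\partial_x u+c(x,t)w=0,\qquad (x,t)\in\Pi,$$ $$w(0,t)=p\,u(0,t),\qquad u(1,t)=0,\qquad t>0,$$ $$w(x,0)=\varphi_1(x),\qquad u(x,0)=\varphi_2(x),\qquad x\in[0,1],$$ where $\varphi_1=w_0$ and $\varphi_2=w_1+a\,\partial_x w_0$ (both in $L^2(0,1)$). For initial data $\varphi_1,\varphi_2$ that are $C^\infty$ with compact support in $(0,1)$, this first order problem has a unique classical ($C^2$) solution. For general $w_0\in H^1(0,1)$, $w_1\in L^2(0,1)$, choose sequences $\varphi_1^l,\varphi_2^l\in C_0^\infty(0,1)$ with $\varphi_i^l\to\varphi_i$ in $L^2(0,1)$, $i=1,2$, and let $(w^l,u^l)$ be the classical solution of the first order problem with initial data $(\varphi_1^l,\varphi_2^l)$. There exist unique functions $w,u\in C([0,\infty),L^2(0,1))$ such that $\|w(\cdot,\theta)-w^l(\cdot,\theta)\|_{L^2(0,1)}\to0$ and $\|u(\cdot,\theta)-u^l(\cdot,\theta)\|_{L^2(0,1)}\to0$ as $l\to\infty$, uniformly in $\theta\in[0,t]$, for every $t>0$ (existence and uniqueness are known). The function $w$ is called the $L^2$-generalized solution of the wave problem. *)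

theory Defs
  imports "HOL-Analysis.Analysis"
begin

subsection \<open>Function spaces on the unit interval\<close>

text \<open>Elements of \<open>L\<^sup>2(0,1)\<close> and \<open>H\<^sup>1(0,1)\<close> are represented by functions on the reals of which
  only the restriction to the unit interval matters; equality in these spaces is equality a.e.\<close>

abbreviation unit_measure :: "real measure" where
  "unit_measure \<equiv> lebesgue_on {0<..<1}"

definition L2 :: "(real \<Rightarrow> real) set" where
  "L2 = {f. f \<in> borel_measurable unit_measure \<and> integrable unit_measure (\<lambda>x. (f x)\<^sup>2)}"

definition L2_norm :: "(real \<Rightarrow> real) \<Rightarrow> real" where
  "L2_norm f = sqrt (LINT x|unit_measure. (f x)\<^sup>2)"

text \<open>\<open>C\<^sub>0\<^sup>\<infinity>(0,1)\<close>, with functions extended by zero to the real line. The closure of the set where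
  such a function is nonzero is bounded, so it is automatically compact.\<close>

definition test_functions :: "(real \<Rightarrow> real) set" where
  "test_functions = {\<phi>. (\<forall>n x. (deriv ^^ n) \<phi> field_differentiable at x) \<and>
     closure {x. \<phi> x \<noteq> 0} \<subseteq> {0<..<1}}"

definition has_weak_derivative :: "(real \<Rightarrow> real) \<Rightarrow> (real \<Rightarrow> real) \<Rightarrow> bool" where
  "has_weak_derivative f g \<longleftrightarrow>
     (\<forall>\<psi>\<in>test_functions. (LINT x|unit_measure. f x * deriv \<psi> x) = - (LINT x|unit_measure. g x * \<psi> x))"

definition H1 :: "(real \<Rightarrow> real) set" where
  "H1 = {f \<in> L2. \<exists>g\<in>L2. has_weak_derivative f g}"

text \<open>Some representative of the weak derivative, which is unique a.e. on the unit interval.\<close>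

definition weak_deriv :: "(real \<Rightarrow> real) \<Rightarrow> real \<Rightarrow> real" where
  "weak_deriv f = (SOME g. g \<in> L2 \<and> has_weak_derivative f g)"

definition H1_norm :: "(real \<Rightarrow> real) \<Rightarrow> real" where
  "H1_norm f = sqrt ((L2_norm f)\<^sup>2 + (L2_norm (weak_deriv f))\<^sup>2)"

text \<open>\<open>C([0,\<infinity>), L\<^sup>2(0,1))\<close>; the arguments of \<open>w\<close> are space and then time.\<close>

definition L2_continuous :: "(real \<Rightarrow> real \<Rightarrow> real) \<Rightarrow> bool" where
  "L2_continuous w \<longleftrightarrow>
     (\<forall>t\<ge>0. (\<lambda>x. w x t) \<in> L2) \<and>
     (\<forall>t\<ge>0. ((\<lambda>s. L2_norm (\<lambda>x. w x s - w x t)) \<longlongrightarrow> 0) (at t within {0..}))"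


subsection \<open>Twice continuously differentiable functions on the closed half-strip\<close>

definition strip :: "(real \<times> real) set" where
  "strip = {0<..<1} \<times> {0<..}"

definition closed_strip :: "(real \<times> real) set" where
  "closed_strip = {0..1} \<times> {0..}"

text \<open>Partial derivatives on the closed half-strip, one-sided at the boundary.\<close>

definition partial_x :: "(real \<Rightarrow> real \<Rightarrow> real) \<Rightarrow> real \<Rightarrow> real \<Rightarrow> real" where
  "partial_x f x t = vector_derivative (\<lambda>y. f y t) (at x within {0..1})"

definition partial_t :: "(real \<Rightarrow> real \<Rightarrow> real) \<Rightarrow> real \<Rightarrow> real \<Rightarrow> real" where
  "partial_t f x t = vector_derivative (\<lambda>s. f x s) (at t within {0..})"

definition C1_closed_strip :: "(real \<Rightarrow> real \<Rightarrow> real) \<Rightarrow> bool" where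
  "C1_closed_strip f \<longleftrightarrow>
     (\<forall>(x, t)\<in>closed_strip. (\<lambda>y. f y t) differentiable (at x within {0..1}) \<and>
                             (\<lambda>s. f x s) differentiable (at t within {0..})) \<and>
     (\<forall>g\<in>{f, partial_x f, partial_t f}. continuous_on closed_strip (\<lambda>(x, t). g x t))"

definition C2_closed_strip :: "(real \<Rightarrow> real \<Rightarrow> real) \<Rightarrow> bool" where
  "C2_closed_strip f \<longleftrightarrow>
     C1_closed_strip f \<and> C1_closed_strip (partial_x f) \<and> C1_closed_strip (partial_t f)"

definition bounded_C2_closed_strip :: "(real \<Rightarrow> real \<Rightarrow> real) \<Rightarrow> bool" where
  "bounded_C2_closed_strip f \<longleftrightarrow>
     C2_closed_strip f \<and>
     (\<forall>g\<in>{f, partial_x f, partial_t f,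
           partial_x (partial_x f), partial_x (partial_t f),
           partial_t (partial_x f), partial_t (partial_t f)}.
        bounded ((\<lambda>(x, t). g x t) ` closed_strip))"


subsection \<open>The wave problem as a first order system\<close>

definition classical_solution ::
  "real \<Rightarrow> real \<Rightarrow> (real \<Rightarrow> real \<Rightarrow> real) \<Rightarrow> (real \<Rightarrow> real) \<Rightarrow> (real \<Rightarrow> real) \<Rightarrow>
   (real \<Rightarrow> real \<Rightarrow> real) \<Rightarrow> (real \<Rightarrow> real \<Rightarrow> real) \<Rightarrow> bool" where
  "classical_solution a p c \<phi>1 \<phi>2 w u \<longleftrightarrow>
     C2_closed_strip w \<and> C2_closed_strip u \<and>
     (\<forall>(x, t)\<in>strip. partial_t w x t + a * partial_x w x t - u x t = 0 \<and>
                      partial_t u x t - a * partial_x u x t + c x t * w x t = 0) \<and>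
     (\<forall>t>0. w 0 t = p * u 0 t \<and> u 1 t = 0) \<and>
     (\<forall>x\<in>{0..1}. w x 0 = \<phi>1 x \<and> u x 0 = \<phi>2 x)"

text \<open>The limit does not depend on the choice of the approximating sequences.\<close>

definition L2_generalized_system_solution ::
  "real \<Rightarrow> real \<Rightarrow> (real \<Rightarrow> real \<Rightarrow> real) \<Rightarrow> (real \<Rightarrow> real) \<Rightarrow> (real \<Rightarrow> real) \<Rightarrow>
   (real \<Rightarrow> real \<Rightarrow> real) \<Rightarrow> (real \<Rightarrow> real \<Rightarrow> real) \<Rightarrow> bool" where
  "L2_generalized_system_solution a p c \<phi>1 \<phi>2 w u \<longleftrightarrow>
     L2_continuous w \<and> L2_continuous u \<and>
     (\<exists>\<phi>1l \<phi>2l wl ul.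
        (\<forall>l::nat. \<phi>1l l \<in> test_functions \<and> \<phi>2l l \<in> test_functions \<and>
                  classical_solution a p c (\<phi>1l l) (\<phi>2l l) (wl l) (ul l)) \<and>
        (\<lambda>l. L2_norm (\<lambda>x. \<phi>1l l x - \<phi>1 x)) \<longlonglongrightarrow> 0 \<and>
        (\<lambda>l. L2_norm (\<lambda>x. \<phi>2l l x - \<phi>2 x)) \<longlonglongrightarrow> 0 \<and>
        (\<forall>t>0. uniform_limit {0..t} (\<lambda>l \<theta>. L2_norm (\<lambda>x. w x \<theta> - wl l x \<theta>)) (\<lambda>_. 0) sequentially \<and>
               uniform_limit {0..t} (\<lambda>l \<theta>. L2_norm (\<lambda>x. u x \<theta> - ul l x \<theta>)) (\<lambda>_. 0) sequentially))"

definition L2_generalized_solution ::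
  "real \<Rightarrow> real \<Rightarrow> (real \<Rightarrow> real \<Rightarrow> real) \<Rightarrow> (real \<Rightarrow> real) \<Rightarrow> (real \<Rightarrow> real) \<Rightarrow>
   (real \<Rightarrow> real \<Rightarrow> real) \<Rightarrow> bool" where
  "L2_generalized_solution a p c w0 w1 w \<longleftrightarrow>
     (\<exists>u. L2_generalized_system_solution a p c w0 (\<lambda>x. w1 x + a * weak_deriv w0 x) w u)"

end

theory Submission
  imports Defs
begin

text \<open>
  Without the coefficient \<open>c\<close> the system only transports: \<open>u\<close> moves left with speed \<open>a\<close>, enters as
  \<open>0\<close> at \<open>x = 1\<close>, is turned into \<open>w\<close> by the reflection at \<open>x = 0\<close>, and \<open>w\<close> moves right and leaves
  through \<open>x = 1\<close>. Every solution is therefore zero after the time \<open>2 / a\<close>, and one expects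
  small perturbations of such a system to decay at any prescribed exponential rate.

  The proof makes this quantitative with the functional
  \<open>V t = \<integral>\<^sub>0\<^sup>1 exp (- \<mu> x) w\<^sup>2 + B exp (\<mu> x) u\<^sup>2 dx\<close>. Each weight decreases in the direction in which its
  component travels, so transport alone dissipates \<open>V\<close> at the rate \<open>a \<mu>\<close>, which can be made as large
  as desired. At \<open>x = 1\<close> nothing enters, and at \<open>x = 0\<close> the flux is \<open>a (p\<^sup>2 - B) u\<^sup>2 \<le> 0\<close> as soon as
  \<open>B \<ge> p\<^sup>2\<close>. The coupling \<open>u\<close> in the equation of \<open>w\<close> is not small, but \<open>w\<close> carries the lighter weight,
  \<open>exp (- \<mu> x) \<le> B exp (\<mu> x)\<close> if \<open>B \<ge> 1\<close>, so it costs at most \<open>V\<close>, independently of \<open>\<mu>\<close>. The coupling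
  \<open>c w\<close> costs at most another \<open>V\<close> if \<open>c\<close> is small compared with the ratio of the weights, and this is
  what fixes \<open>\<epsilon>\<close>. Together \<open>V' \<le> - (a \<mu> - 2) V\<close> for classical solutions
  (\<open>energy_dissipation\<close>), so \<open>V\<close> decays exponentially (\<open>energy_decay\<close>), and \<open>V\<close> is equivalent to the
  square of the \<open>L\<^sup>2\<close> norm. The resulting bound (\<open>classical_solution_decay\<close>) involves the data only
  through their \<open>L\<^sup>2\<close> norms and hence survives the limit that defines generalized solutions.
\<close>

section \<open>The norm of square integrable functions\<close>

lemma L2_norm_nonneg [simp]: "0 \<le> L2_norm f"
  by (simp add: L2_norm_def)

lemma L2_norm_power2: "(L2_norm f)\<^sup>2 = (LINT x|unit_measure. (f x)\<^sup>2)"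
  by (simp add: L2_norm_def)

lemma L2_add:
  assumes "f \<in> L2" "g \<in> L2"
  shows "(\<lambda>x. f x + g x) \<in> L2"
proof -
  have f: "f \<in> borel_measurable unit_measure" "integrable unit_measure (\<lambda>x. (f x)\<^sup>2)"
    and g: "g \<in> borel_measurable unit_measure" "integrable unit_measure (\<lambda>x. (g x)\<^sup>2)"
    using assms by (auto simp: L2_def)
  have "(f x + g x)\<^sup>2 \<le> 2 * (f x)\<^sup>2 + 2 * (g x)\<^sup>2" for x
    using zero_le_power2[of "f x - g x"] by (simp add: power2_eq_square algebra_simps)
  then have "integrable unit_measure (\<lambda>x. (f x + g x)\<^sup>2)"
    by (intro Bochner_Integration.integrable_bound
          [OF Bochner_Integration.integrable_add
            [OF integrable_mult_right[OF f(2), of 2] integrable_mult_right[OF g(2), of 2]]])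
       (use f(1) g(1) in auto)
  then show ?thesis
    using f g by (simp add: L2_def)
qed

lemma L2_scale: "f \<in> L2 \<Longrightarrow> (\<lambda>x. k * f x) \<in> L2"
  by (auto simp: L2_def power_mult_distrib)

lemma L2_diff: "f \<in> L2 \<Longrightarrow> g \<in> L2 \<Longrightarrow> (\<lambda>x. f x - g x) \<in> L2"
  using L2_add[of f "\<lambda>x. - 1 * g x"] L2_scale[of g "- 1"] by simp

lemma L2_norm_scale: "L2_norm (\<lambda>x. k * f x) = \<bar>k\<bar> * L2_norm f"
  by (simp add: L2_norm_def power_mult_distrib real_sqrt_mult)

text \<open>Integrating \<open>(f + g)\<^sup>2 \<le> (1 + s) f\<^sup>2 + (1 + 1 / s) g\<^sup>2\<close> gives the triangle inequality for the
  ratio \<open>s\<close> of the two norms. Enlarging both norms by an arbitrarily small positive amount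
  keeps this ratio meaningful when one of them vanishes.\<close>

lemma L2_norm_triangle:
  assumes "f \<in> L2" "g \<in> L2"
  shows "L2_norm (\<lambda>x. f x + g x) \<le> L2_norm f + L2_norm g"
proof (rule field_le_epsilon)
  fix \<eta> :: real assume "\<eta> > 0"
  define A where "A = L2_norm f + \<eta> / 2"
  define B where "B = L2_norm g + \<eta> / 2"
  have pos: "A > 0" "B > 0"
    using \<open>\<eta> > 0\<close> by (auto simp: A_def B_def add_nonneg_pos)
  have f: "integrable unit_measure (\<lambda>x. (f x)\<^sup>2)"
    and g: "integrable unit_measure (\<lambda>x. (g x)\<^sup>2)"
    and fg: "integrable unit_measure (\<lambda>x. (f x + g x)\<^sup>2)"
    using assms L2_add[OF assms] by (auto simp: L2_def)
  have young: "(y + z)\<^sup>2 \<le> (A + B) / A * y\<^sup>2 + (A + B) / B * z\<^sup>2" for y z :: real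
  proof -
    have "(A + B) / A * y\<^sup>2 + (A + B) / B * z\<^sup>2 - (y + z)\<^sup>2 = (B * y - A * z)\<^sup>2 / (A * B)"
      using pos by (simp add: field_simps power2_eq_square)
    also have "\<dots> \<ge> 0"
      using pos by simp
    finally show ?thesis by simp
  qed
  have "(L2_norm (\<lambda>x. f x + g x))\<^sup>2 = (LINT x|unit_measure. (f x + g x)\<^sup>2)"
    by (rule L2_norm_power2)
  also have "\<dots> \<le> (LINT x|unit_measure. (A + B) / A * (f x)\<^sup>2 + (A + B) / B * (g x)\<^sup>2)"
    by (intro integral_mono fg young Bochner_Integration.integrable_add integrable_mult_right f g)
  also have "\<dots> = (A + B) / A * (L2_norm f)\<^sup>2 + (A + B) / B * (L2_norm g)\<^sup>2"
    using f g by (simp add: L2_norm_power2)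
  also have "\<dots> \<le> (A + B) / A * A\<^sup>2 + (A + B) / B * B\<^sup>2"
    using pos \<open>\<eta> > 0\<close> by (intro add_mono mult_left_mono power_mono) (auto simp: A_def B_def)
  also have "\<dots> = (A + B)\<^sup>2"
  proof -
    have "(A + B) / A * A\<^sup>2 = (A + B) * A" "(A + B) / B * B\<^sup>2 = (A + B) * B"
      using pos by (simp_all add: power2_eq_square)
    then show ?thesis
      by (simp add: power2_eq_square distrib_left)
  qed
  finally have "L2_norm (\<lambda>x. f x + g x) \<le> A + B"
    by (rule power2_le_imp_le) (use pos in simp)
  then show "L2_norm (\<lambda>x. f x + g x) \<le> L2_norm f + L2_norm g + \<eta>"
    by (simp add: A_def B_def)
qed

lemma L2_norm_le_add_diff:
  assumes "f \<in> L2" "g \<in> L2"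
  shows "L2_norm f \<le> L2_norm g + L2_norm (\<lambda>x. f x - g x)"
  using L2_norm_triangle[OF assms(2) L2_diff[OF assms]] by simp

lemma continuous_imp_L2:
  assumes "continuous_on {0..1} f"
  shows "f \<in> L2"
    and L2_norm_continuous: "(L2_norm f)\<^sup>2 = integral {0..1} (\<lambda>x. (f x)\<^sup>2)"
proof -
  have cont: "continuous_on {0..1} (\<lambda>x. (f x)\<^sup>2)"
    using assms by (intro continuous_intros)
  have "set_integrable lebesgue {0..1} (\<lambda>x. (f x)\<^sup>2)"
    using continuous_imp_integrable_real[OF cont]
    by (simp add: integrable_restrict_space set_integrable_def)
  then have "set_integrable lebesgue {0<..<1} (\<lambda>x. (f x)\<^sup>2)"
    by (rule set_integrable_subset) auto
  then have int: "integrable unit_measure (\<lambda>x. (f x)\<^sup>2)"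
    by (simp add: integrable_restrict_space set_integrable_def)
  have "f \<in> borel_measurable unit_measure"
    using assms by (intro continuous_imp_measurable_on_sets_lebesgue)
      (auto intro: continuous_on_subset)
  with int show "f \<in> L2"
    by (simp add: L2_def)
  have "(L2_norm f)\<^sup>2 = integral {0<..<1} (\<lambda>x. (f x)\<^sup>2)"
    unfolding L2_norm_power2 using int by (rule lebesgue_integral_eq_integral) simp
  then show "(L2_norm f)\<^sup>2 = integral {0..1} (\<lambda>x. (f x)\<^sup>2)"
    by (simp add: integral_open_interval_real)
qed

lemma test_function_L2:
  assumes "\<phi> \<in> test_functions"
  shows "\<phi> \<in> L2"
proof -
  have "\<phi> field_differentiable at x" for x
    using assms unfolding test_functions_def by (auto dest!: spec[of _ "0::nat"])
  then have "continuous_on {0..1} \<phi>"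
    by (intro continuous_at_imp_continuous_on) (auto intro: field_differentiable_imp_continuous_at)
  then show ?thesis
    by (rule continuous_imp_L2)
qed

section \<open>Continuously differentiable functions on the closed half-strip\<close>

lemma C1_closed_strip_partials:
  assumes "C1_closed_strip f" "x \<in> {0..1}" "t \<in> {0..}"
  shows "((\<lambda>y. f y t) has_real_derivative partial_x f x t) (at x within {0..1})"
    and "((\<lambda>s. f x s) has_real_derivative partial_t f x t) (at t within {0..})"
proof -
  have "(x, t) \<in> closed_strip"
    using assms by (simp add: closed_strip_def)
  then have diff: "(\<lambda>y. f y t) differentiable (at x within {0..1})"
    "(\<lambda>s. f x s) differentiable (at t within {0..})"
    using assms(1) unfolding C1_closed_strip_def by blast+
  show "((\<lambda>y. f y t) has_real_derivative partial_x f x t) (at x within {0..1})"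
    unfolding partial_x_def has_real_derivative_iff_has_vector_derivative
    using diff(1) by (rule vector_derivative_works[THEN iffD1])
  show "((\<lambda>s. f x s) has_real_derivative partial_t f x t) (at t within {0..})"
    unfolding partial_t_def has_real_derivative_iff_has_vector_derivative
    using diff(2) by (rule vector_derivative_works[THEN iffD1])
qed

lemma C1_closed_strip_continuous:
  assumes "C1_closed_strip f"
  shows "continuous_on ({0..} \<times> {0..1}) (\<lambda>z. f (snd z) (fst z))"
    and "continuous_on ({0..} \<times> {0..1}) (\<lambda>z. partial_t f (snd z) (fst z))"
proof -
  have "continuous_on ({0..} \<times> {0..1}) (\<lambda>z. g (snd z) (fst z))"
    if "continuous_on closed_strip (\<lambda>(x, t). g x t)" for g :: "real \<Rightarrow> real \<Rightarrow> real"
  proof -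
    have "continuous_on ({0..} \<times> {0..1}) ((\<lambda>(x, t). g x t) \<circ> prod.swap)"
      using that by (intro continuous_on_compose continuous_on_swap)
        (auto simp: closed_strip_def product_swap)
    then show ?thesis
      by (simp add: o_def case_prod_unfold)
  qed
  note swap = this
  have "\<forall>g\<in>{f, partial_x f, partial_t f}. continuous_on closed_strip (\<lambda>(x, t). g x t)"
    using assms unfolding C1_closed_strip_def by (rule conjunct2)
  then show "continuous_on ({0..} \<times> {0..1}) (\<lambda>z. f (snd z) (fst z))"
    "continuous_on ({0..} \<times> {0..1}) (\<lambda>z. partial_t f (snd z) (fst z))"
    by (intro swap; simp)+
qed

lemma C1_closed_strip_slice:
  assumes "C1_closed_strip f" "t \<ge> 0"
  shows "continuous_on {0..1} (\<lambda>x. f x t)"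
proof (rule DERIV_continuous_on)
  fix x :: real assume "x \<in> {0..1}"
  then show "((\<lambda>x. f x t) has_real_derivative partial_x f x t) (at x within {0..1})"
    using assms(2) by (intro C1_closed_strip_partials(1)[OF assms(1)]) auto
qed

lemma classical_solution_C1:
  assumes "classical_solution a p c \<phi>1 \<phi>2 w u"
  shows "C1_closed_strip w" "C1_closed_strip u"
  using assms unfolding classical_solution_def C2_closed_strip_def by - (elim conjE, assumption)+

section \<open>Decay of the weighted energy of classical solutions\<close>

definition energy :: "real \<Rightarrow> real \<Rightarrow> (real \<Rightarrow> real \<Rightarrow> real) \<Rightarrow> (real \<Rightarrow> real \<Rightarrow> real) \<Rightarrow> real \<Rightarrow> real"
  where "energy \<mu> B w u t =
    integral {0..1} (\<lambda>x. exp (- \<mu> * x) * (w x t)\<^sup>2 + B * exp (\<mu> * x) * (u x t)\<^sup>2)"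

lemma energy_integrand_continuous:
  assumes "C1_closed_strip w" "C1_closed_strip u" "t \<ge> 0"
  shows "continuous_on {0..1} (\<lambda>x. exp (- \<mu> * x) * (w x t)\<^sup>2 + B * exp (\<mu> * x) * (u x t)\<^sup>2)"
  by (intro continuous_intros C1_closed_strip_slice[OF assms(1,3)] C1_closed_strip_slice[OF assms(2,3)])

lemma energy_has_derivative:
  fixes \<mu> B :: real
  assumes w: "C1_closed_strip w" and u: "C1_closed_strip u" and "t \<ge> 0"
  defines "D \<equiv> \<lambda>s x. 2 * exp (- \<mu> * x) * w x s * partial_t w x s
                     + 2 * B * exp (\<mu> * x) * u x s * partial_t u x s"
  shows "(energy \<mu> B w u has_real_derivative integral {0..1} (D t)) (at t within {0..})"
    and "D t integrable_on {0..1}"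
proof -
  have cont: "continuous_on ({0..} \<times> {0..1}) (\<lambda>(s, x). D s x)"
    unfolding D_def case_prod_unfold
    by (intro continuous_intros C1_closed_strip_continuous[OF w] C1_closed_strip_continuous[OF u])
  have "((\<lambda>s. integral (cbox 0 1) (\<lambda>x. exp (- \<mu> * x) * (w x s)\<^sup>2 + B * exp (\<mu> * x) * (u x s)\<^sup>2))
      has_field_derivative integral (cbox 0 1) (D t)) (at t within {0..})"
  proof (rule leibniz_rule_field_derivative)
    fix s x :: real assume s: "s \<in> {0..}" and x: "x \<in> cbox 0 1"
    have x: "x \<in> {0..1}" using x by simp
    show "((\<lambda>s. exp (- \<mu> * x) * (w x s)\<^sup>2 + B * exp (\<mu> * x) * (u x s)\<^sup>2)
        has_field_derivative D s x) (at s within {0..})"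
      unfolding D_def
      by (rule derivative_eq_intros C1_closed_strip_partials(2)[OF w x s]
          C1_closed_strip_partials(2)[OF u x s] refl)+ (simp add: algebra_simps)
  next
    fix s :: real assume "s \<in> {0..}"
    then show "(\<lambda>x. exp (- \<mu> * x) * (w x s)\<^sup>2 + B * exp (\<mu> * x) * (u x s)\<^sup>2) integrable_on cbox 0 1"
      using energy_integrand_continuous[OF w u, of s \<mu> B]
      by (simp add: integrable_continuous_real)
  qed (use cont \<open>t \<ge> 0\<close> in auto)
  then show "(energy \<mu> B w u has_real_derivative integral {0..1} (D t)) (at t within {0..})"
    by (simp add: energy_def[abs_def])
  have "continuous_on {0..1} (D t)"
    using continuous_on_compose2[OF cont, of "{0..1}" "Pair t"] \<open>t \<ge> 0\<close>
      continuous_on_Pair[of "{0..1}" "\<lambda>_. t" "\<lambda>x. x"]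
    by (simp add: image_subset_iff)
  then show "D t integrable_on {0..1}"
    by (rule integrable_continuous_real)
qed

text \<open>The two couplings are absorbed by the energy density \<open>e y\<^sup>2 + B f z\<^sup>2\<close>, where \<open>e\<close> and \<open>f\<close> are
  the weights, \<open>y\<close> and \<open>z\<close> the values of \<open>w\<close> and \<open>u\<close>. The first one needs \<open>e \<le> B f\<close>; the second one,
  in which \<open>z\<close> carries the heavier weight, needs \<open>B f k\<^sup>2 \<le> e\<close>.\<close>

lemma coupling_terms_le:
  fixes e f B k y z :: real
  assumes "0 \<le> e" "0 \<le> B * f" "e \<le> B * f" "B * f * k\<^sup>2 \<le> e"
  shows "2 * e * y * z - 2 * B * f * k * z * y \<le> 2 * (e * y\<^sup>2 + B * f * z\<^sup>2)"
proof -
  have "0 \<le> e * (y - z)\<^sup>2" "0 \<le> B * f * (z + k * y)\<^sup>2"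
    using assms by (auto intro: mult_nonneg_nonneg)
  moreover have "e * z\<^sup>2 \<le> B * f * z\<^sup>2" "(B * f * k\<^sup>2) * y\<^sup>2 \<le> e * y\<^sup>2"
    using assms by (auto intro: mult_right_mono)
  ultimately show ?thesis
    by (simp add: power2_eq_square algebra_simps)
qed

text \<open>Inserting the equations, the time derivative of the energy density is the \<open>x\<close>-derivative of
  the flux \<open>G = a (B exp (\<mu> x) u\<^sup>2 - exp (- \<mu> x) w\<^sup>2)\<close>, minus \<open>a \<mu>\<close> times the density (from
  differentiating the weights), plus the couplings. The boundary conditions make \<open>G 1 - G 0\<close> nonpositive.\<close>

lemma energy_dissipation:
  assumes sol: "classical_solution a p c \<phi>1 \<phi>2 w u"
    and "a > 0" "\<mu> \<ge> 0" "p\<^sup>2 \<le> B" "1 \<le> B"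
    and c: "\<And>x t. (x, t) \<in> strip \<Longrightarrow> \<bar>c x t\<bar> \<le> \<epsilon>" and \<epsilon>: "B * exp (2 * \<mu>) * \<epsilon>\<^sup>2 \<le> 1"
    and "t > 0"
  shows "\<exists>D. DERIV (energy \<mu> B w u) t :> D \<and> D \<le> - (a * \<mu> - 2) * energy \<mu> B w u t"
proof -
  note C1 = classical_solution_C1[OF sol]
  define E where "E x = exp (- \<mu> * x) * (w x t)\<^sup>2 + B * exp (\<mu> * x) * (u x t)\<^sup>2" for x
  define D where "D x = 2 * exp (- \<mu> * x) * w x t * partial_t w x t
                     + 2 * B * exp (\<mu> * x) * u x t * partial_t u x t" for x
  define G where "G x = a * (B * exp (\<mu> * x) * (u x t)\<^sup>2 - exp (- \<mu> * x) * (w x t)\<^sup>2)" for x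
  define G' where "G' x = a * \<mu> * E x + 2 * a * (B * exp (\<mu> * x) * u x t * partial_x u x t
                     - exp (- \<mu> * x) * w x t * partial_x w x t)" for x
  have "t \<ge> 0" using \<open>t > 0\<close> by simp
  have deriv: "(energy \<mu> B w u has_real_derivative integral {0..1} D) (at t within {0..})"
    and D_int: "D integrable_on {0..1}"
    using energy_has_derivative[OF C1 \<open>t \<ge> 0\<close>, of \<mu> B] by (simp_all add: D_def[abs_def])
  have "at t within {0..} = at t"
    using \<open>t > 0\<close> by (intro at_within_interior) simp
  with deriv have deriv: "DERIV (energy \<mu> B w u) t :> integral {0..1} D"
    by simp
  have E: "(E has_integral energy \<mu> B w u t) {0..1}"
    using energy_integrand_continuous[OF C1 \<open>t \<ge> 0\<close>, of \<mu> B]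
    by (simp add: E_def[abs_def] energy_def integrable_integral integrable_continuous_real)
  have G: "(G' has_integral (G 1 - G 0)) {0..1}"
  proof (rule fundamental_theorem_of_calculus)
    fix x :: real assume x: "x \<in> {0..1}"
    have t: "t \<in> {0..}" using \<open>t > 0\<close> by simp
    have "(G has_real_derivative G' x) (at x within {0..1})"
      unfolding G_def G'_def E_def
      by (rule derivative_eq_intros C1_closed_strip_partials(1)[OF C1(1) x t]
          C1_closed_strip_partials(1)[OF C1(2) x t] refl)+
         (simp add: algebra_simps power2_eq_square)
    then show "(G has_vector_derivative G' x) (at x within {0..1})"
      by (simp add: has_real_derivative_iff_has_vector_derivative)
  qed simp
  have "((\<lambda>x. G' x - (a * \<mu> - 2) * E x)
      has_integral (G 1 - G 0) - (a * \<mu> - 2) * energy \<mu> B w u t) {0..1}"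
    using has_integral_diff[OF G has_integral_mult_right[OF E]] .
  then have bound: "((\<lambda>x. G' x - (a * \<mu> - 2) * E x)
      has_integral (G 1 - G 0) - (a * \<mu> - 2) * energy \<mu> B w u t) {0<..<1}"
    by (simp only: has_integral_Icc_iff_Ioo)
  have D_Ioo: "(D has_integral integral {0..1} D) {0<..<1}"
    using integrable_integral[OF D_int] by (simp only: has_integral_Icc_iff_Ioo)
  \<comment> \<open>The equations hold in the open strip only, so the comparison is made on the open interval.\<close>
  have le: "D x \<le> G' x - (a * \<mu> - 2) * E x" if x: "x \<in> {0<..<1}" for x
  proof -
    have xt: "(x, t) \<in> strip" using x \<open>t > 0\<close> by (simp add: strip_def)
    have eqs: "partial_t w x t = u x t - a * partial_x w x t"
      "partial_t u x t = a * partial_x u x t - c x t * w x t"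
    proof -
      have "partial_t w x t + a * partial_x w x t - u x t = 0 \<and>
            partial_t u x t - a * partial_x u x t + c x t * w x t = 0"
        using sol xt unfolding classical_solution_def by blast
      then show "partial_t w x t = u x t - a * partial_x w x t"
        "partial_t u x t = a * partial_x u x t - c x t * w x t"
        by linarith+
    qed
    have e: "exp (- \<mu> * x) \<le> 1" and f: "1 \<le> exp (\<mu> * x)"
      using x \<open>\<mu> \<ge> 0\<close> by auto
    have "1 * 1 \<le> B * exp (\<mu> * x)"
      using f \<open>1 \<le> B\<close> by (intro mult_mono) auto
    with e have "exp (- \<mu> * x) \<le> B * exp (\<mu> * x)" by linarith
    moreover have "B * exp (\<mu> * x) * (c x t)\<^sup>2 \<le> exp (- \<mu> * x)"
    proof -
      have "(c x t)\<^sup>2 \<le> \<epsilon>\<^sup>2"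
        using c[OF xt] by (rule power2_le_iff_abs_le[THEN iffD2, rotated]) (use c[OF xt] in simp)
      then have "B * exp (2 * \<mu> * x) * (c x t)\<^sup>2 \<le> B * exp (2 * \<mu>) * \<epsilon>\<^sup>2"
        using x \<open>\<mu> \<ge> 0\<close> \<open>1 \<le> B\<close>
        by (intro mult_mono) (auto simp: mult_left_le)
      then have "B * exp (2 * \<mu> * x) * (c x t)\<^sup>2 \<le> 1"
        using \<epsilon> by linarith
      then have "exp (- \<mu> * x) * (B * exp (2 * \<mu> * x) * (c x t)\<^sup>2) \<le> exp (- \<mu> * x)"
        by (intro mult_left_le) auto
      moreover have "exp (\<mu> * x) = exp (- \<mu> * x) * exp (2 * \<mu> * x)"
        by (simp flip: exp_add)
      then have "B * exp (\<mu> * x) * (c x t)\<^sup>2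
          = exp (- \<mu> * x) * (B * exp (2 * \<mu> * x) * (c x t)\<^sup>2)"
        by simp
      ultimately show ?thesis by linarith
    qed
    ultimately have "2 * exp (- \<mu> * x) * w x t * u x t
        - 2 * B * exp (\<mu> * x) * c x t * u x t * w x t \<le> 2 * E x"
      unfolding E_def using \<open>1 \<le> B\<close> by (intro coupling_terms_le) auto
    then show ?thesis
      unfolding D_def G'_def eqs by (simp add: algebra_simps)
  qed
  have "integral {0..1} D \<le> (G 1 - G 0) - (a * \<mu> - 2) * energy \<mu> B w u t"
    using D_Ioo bound le by (rule has_integral_le)
  moreover have "G 1 \<le> G 0"
  proof -
    have bc: "w 0 t = p * u 0 t" "u 1 t = 0"
      using sol \<open>t > 0\<close> unfolding classical_solution_def by blast+
    have "G 1 = - (a * (exp (- \<mu>) * (w 1 t)\<^sup>2))" "G 0 = a * ((B - p\<^sup>2) * (u 0 t)\<^sup>2)"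
      by (simp_all add: G_def bc power_mult_distrib algebra_simps)
    moreover have "0 \<le> a * (exp (- \<mu>) * (w 1 t)\<^sup>2)" "0 \<le> a * ((B - p\<^sup>2) * (u 0 t)\<^sup>2)"
      using \<open>a > 0\<close> \<open>p\<^sup>2 \<le> B\<close> by auto
    ultimately show ?thesis by linarith
  qed
  ultimately have "integral {0..1} D \<le> - (a * \<mu> - 2) * energy \<mu> B w u t"
    by (simp add: algebra_simps)
  with deriv show ?thesis by blast
qed

lemma exponential_decay:
  fixes f :: "real \<Rightarrow> real"
  assumes "t \<ge> 0" and cont: "continuous_on {0..t} f"
    and f: "\<And>s. 0 < s \<Longrightarrow> \<exists>D. DERIV f s :> D \<and> D \<le> - r * f s"
  shows "f t \<le> exp (- r * t) * f 0"
proof -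
  have "exp (r * 0) * f 0 \<ge> exp (r * t) * f t"
  proof (rule DERIV_nonpos_imp_decreasing_open[OF \<open>t \<ge> 0\<close>])
    fix s assume "0 < s" "s < t"
    obtain D where D: "DERIV f s :> D" "D \<le> - r * f s"
      using f[OF \<open>0 < s\<close>] by blast
    have "DERIV (\<lambda>s. exp (r * s) * f s) s :> exp (r * s) * (D + r * f s)"
      by (rule derivative_eq_intros D refl)+ (simp add: algebra_simps)
    moreover have "exp (r * s) * (D + r * f s) \<le> 0"
      using D(2) by (simp add: mult_le_0_iff)
    ultimately show "\<exists>y. DERIV (\<lambda>s. exp (r * s) * f s) s :> y \<and> y \<le> 0"
      by blast
  qed (intro continuous_intros cont)
  then have "exp (- r * t) * (exp (r * t) * f t) \<le> exp (- r * t) * f 0"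
    by (intro mult_left_mono) auto
  then show ?thesis
    by (simp add: mult.assoc[symmetric] exp_minus)
qed

lemma energy_decay:
  assumes sol: "classical_solution a p c \<phi>1 \<phi>2 w u"
    and "a > 0" "\<mu> \<ge> 0" "p\<^sup>2 \<le> B" "1 \<le> B"
    and "\<And>x t. (x, t) \<in> strip \<Longrightarrow> \<bar>c x t\<bar> \<le> \<epsilon>" "B * exp (2 * \<mu>) * \<epsilon>\<^sup>2 \<le> 1"
    and "t \<ge> 0"
  shows "energy \<mu> B w u t \<le> exp (- (a * \<mu> - 2) * t) * energy \<mu> B w u 0"
proof (rule exponential_decay[OF \<open>t \<ge> 0\<close>])
  have "continuous_on {0..} (energy \<mu> B w u)"
    by (rule DERIV_continuous_on, rule energy_has_derivative(1)[OF classical_solution_C1[OF sol]])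
      simp
  then show "continuous_on {0..t} (energy \<mu> B w u)"
    by (rule continuous_on_subset) auto
qed (rule energy_dissipation[OF assms(1-7)])

lemma energy_lower_bound:
  assumes "C1_closed_strip w" "C1_closed_strip u" "t \<ge> 0" "\<mu> \<ge> 0" "B \<ge> 0"
  shows "exp (- \<mu>) * (L2_norm (\<lambda>x. w x t))\<^sup>2 \<le> energy \<mu> B w u t"
proof -
  have w: "continuous_on {0..1} (\<lambda>x. w x t)"
    using assms by (intro C1_closed_strip_slice)
  have "exp (- \<mu>) * (L2_norm (\<lambda>x. w x t))\<^sup>2 = integral {0..1} (\<lambda>x. exp (- \<mu>) * (w x t)\<^sup>2)"
    by (simp add: L2_norm_continuous[OF w])
  also have "\<dots> \<le> energy \<mu> B w u t"
    unfolding energy_def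
  proof (rule integral_le)
    show "exp (- \<mu>) * (w x t)\<^sup>2 \<le> exp (- \<mu> * x) * (w x t)\<^sup>2 + B * exp (\<mu> * x) * (u x t)\<^sup>2"
      if "x \<in> {0..1}" for x
    proof -
      have "exp (- \<mu>) * (w x t)\<^sup>2 \<le> exp (- \<mu> * x) * (w x t)\<^sup>2"
        using that \<open>\<mu> \<ge> 0\<close> by (intro mult_right_mono) (auto simp: mult_left_le)
      moreover have "0 \<le> B * exp (\<mu> * x) * (u x t)\<^sup>2"
        using \<open>B \<ge> 0\<close> by simp
      ultimately show ?thesis by linarith
    qed
    show "(\<lambda>x. exp (- \<mu>) * (w x t)\<^sup>2) integrable_on {0..1}"
      by (intro integrable_continuous_real continuous_intros w)
    show "(\<lambda>x. exp (- \<mu> * x) * (w x t)\<^sup>2 + B * exp (\<mu> * x) * (u x t)\<^sup>2) integrable_on {0..1}"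
      using assms by (intro integrable_continuous_real energy_integrand_continuous)
  qed
  finally show ?thesis .
qed

lemma energy_upper_bound:
  assumes "C1_closed_strip w" "C1_closed_strip u" "t \<ge> 0" "\<mu> \<ge> 0" "B \<ge> 1"
  shows "energy \<mu> B w u t \<le> B * exp \<mu> * ((L2_norm (\<lambda>x. w x t))\<^sup>2 + (L2_norm (\<lambda>x. u x t))\<^sup>2)"
proof -
  have w: "continuous_on {0..1} (\<lambda>x. w x t)" and u: "continuous_on {0..1} (\<lambda>x. u x t)"
    using assms by (auto intro: C1_closed_strip_slice)
  have int: "(\<lambda>x. (w x t)\<^sup>2) integrable_on {0..1}" "(\<lambda>x. (u x t)\<^sup>2) integrable_on {0..1}"
    by (intro integrable_continuous_real continuous_intros w u)+
  have "energy \<mu> B w u t \<le> integral {0..1} (\<lambda>x. B * exp \<mu> * ((w x t)\<^sup>2 + (u x t)\<^sup>2))"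
    unfolding energy_def
  proof (rule integral_le)
    show "exp (- \<mu> * x) * (w x t)\<^sup>2 + B * exp (\<mu> * x) * (u x t)\<^sup>2
        \<le> B * exp \<mu> * ((w x t)\<^sup>2 + (u x t)\<^sup>2)" if x: "x \<in> {0..1}" for x
    proof -
      have "1 * 1 \<le> B * exp \<mu>"
        using assms by (intro mult_mono) auto
      moreover have "exp (- \<mu> * x) \<le> 1"
        using x \<open>\<mu> \<ge> 0\<close> by simp
      ultimately have "exp (- \<mu> * x) \<le> B * exp \<mu>"
        by linarith
      then have "exp (- \<mu> * x) * (w x t)\<^sup>2 \<le> B * exp \<mu> * (w x t)\<^sup>2"
        by (intro mult_right_mono) auto
      moreover have "B * exp (\<mu> * x) * (u x t)\<^sup>2 \<le> B * exp \<mu> * (u x t)\<^sup>2"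
        using x assms by (intro mult_right_mono mult_left_mono) (auto simp: mult_left_le)
      ultimately show ?thesis by (simp add: algebra_simps)
    qed
    show "(\<lambda>x. exp (- \<mu> * x) * (w x t)\<^sup>2 + B * exp (\<mu> * x) * (u x t)\<^sup>2) integrable_on {0..1}"
      using assms by (intro integrable_continuous_real energy_integrand_continuous)
    show "(\<lambda>x. B * exp \<mu> * ((w x t)\<^sup>2 + (u x t)\<^sup>2)) integrable_on {0..1}"
      by (intro integrable_continuous_real continuous_intros w u)
  qed
  also have "\<dots> = B * exp \<mu> * ((L2_norm (\<lambda>x. w x t))\<^sup>2 + (L2_norm (\<lambda>x. u x t))\<^sup>2)"
    using int by (simp add: L2_norm_continuous[OF w] L2_norm_continuous[OF u]
        Henstock_Kurzweil_Integration.integral_add)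
  finally show ?thesis .
qed

text \<open>With \<open>B = (1 + \<bar>p\<bar>)\<^sup>2\<close> both requirements \<open>B \<ge> p\<^sup>2\<close> and \<open>B \<ge> 1\<close> hold, and \<open>K\<^sup>2 = B exp (2 \<mu>)\<close>
  plays two roles: it is the quotient of the factors \<open>B exp \<mu>\<close> and \<open>exp (- \<mu>)\<close> that compare \<open>V\<close> with
  squared \<open>L\<^sup>2\<close> norms from above and from below, and \<open>\<epsilon> = 1 / K\<close> satisfies the smallness condition of
  the dissipation estimate. The choice of \<open>\<mu>\<close> gives \<open>a \<mu> - 2 = 2 \<gamma>\<close>: since \<open>V\<close> is quadratic, it must
  decay at twice the desired rate.\<close>

lemma classical_solution_decay:
  fixes \<gamma> \<mu> K :: real
  assumes sol: "classical_solution a p c \<phi>1 \<phi>2 w u"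
    and "a > 0" "\<gamma> > 0" "t \<ge> 0"
  defines "\<mu> \<equiv> (2 * \<gamma> + 2) / a"
  defines "K \<equiv> (1 + \<bar>p\<bar>) * exp \<mu>"
  assumes c: "\<And>x t. (x, t) \<in> strip \<Longrightarrow> \<bar>c x t\<bar> \<le> 1 / K"
  shows "L2_norm (\<lambda>x. w x t) \<le> K * exp (- \<gamma> * t) * (L2_norm \<phi>1 + L2_norm \<phi>2)"
proof -
  define B where "B = (1 + \<bar>p\<bar>)\<^sup>2"
  note C1 = classical_solution_C1[OF sol]
  have \<mu>: "\<mu> \<ge> 0" and rate: "a * \<mu> - 2 = 2 * \<gamma>"
    using \<open>a > 0\<close> \<open>\<gamma> > 0\<close> by (auto simp: \<mu>_def)
  have K: "K > 0" and K2: "K\<^sup>2 = B * exp (2 * \<mu>)"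
    by (auto simp: K_def B_def power_mult_distrib exp_double)
  have B: "p\<^sup>2 \<le> B" "1 \<le> B"
    by (auto simp: B_def abs_le_square_iff[symmetric])
  have "w x 0 = \<phi>1 x \<and> u x 0 = \<phi>2 x" if "x \<in> {0..1}" for x
    using sol that unfolding classical_solution_def by blast
  then have init: "L2_norm (\<lambda>x. w x 0) = L2_norm \<phi>1" "L2_norm (\<lambda>x. u x 0) = L2_norm \<phi>2"
    unfolding L2_norm_def
    by (intro arg_cong[of _ _ sqrt] Bochner_Integration.integral_cong refl; simp)+
  have "exp (- \<mu>) * (L2_norm (\<lambda>x. w x t))\<^sup>2 \<le> energy \<mu> B w u t"
    using C1 \<open>t \<ge> 0\<close> \<mu> B by (intro energy_lower_bound) auto
  also have "\<dots> \<le> exp (- (a * \<mu> - 2) * t) * energy \<mu> B w u 0"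
    using K by (intro energy_decay[OF sol \<open>a > 0\<close> \<mu> B c _ \<open>t \<ge> 0\<close>])
      (auto simp: power_divide simp flip: K2)
  also have "\<dots> \<le> exp (- (a * \<mu> - 2) * t) * (B * exp \<mu> * ((L2_norm \<phi>1)\<^sup>2 + (L2_norm \<phi>2)\<^sup>2))"
    using energy_upper_bound[OF C1 order_refl \<mu> B(2)] by (simp add: init)
  also have "\<dots> \<le> exp (- (a * \<mu> - 2) * t) * (B * exp \<mu> * (L2_norm \<phi>1 + L2_norm \<phi>2)\<^sup>2)"
    using B by (intro mult_left_mono) (auto simp: power2_sum)
  finally have "exp \<mu> * (exp (- \<mu>) * (L2_norm (\<lambda>x. w x t))\<^sup>2)
      \<le> exp \<mu> * (exp (- (2 * \<gamma>) * t) * (B * exp \<mu> * (L2_norm \<phi>1 + L2_norm \<phi>2)\<^sup>2))"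
    by (intro mult_left_mono) (auto simp: rate)
  also have "\<dots> = (B * (exp \<mu> * exp \<mu>)) * exp (- (2 * \<gamma>) * t) * (L2_norm \<phi>1 + L2_norm \<phi>2)\<^sup>2"
    by (simp add: mult_ac)
  also have "\<dots> = (K * exp (- \<gamma> * t) * (L2_norm \<phi>1 + L2_norm \<phi>2))\<^sup>2"
    by (simp add: power_mult_distrib K2 mult_exp_exp exp_double[symmetric])
  finally have "(L2_norm (\<lambda>x. w x t))\<^sup>2 \<le> (K * exp (- \<gamma> * t) * (L2_norm \<phi>1 + L2_norm \<phi>2))\<^sup>2"
    by (simp add: mult.assoc[symmetric] mult_exp_exp)
  then show ?thesis
    by (rule power2_le_imp_le) (use K in simp)
qed

section \<open>Passage to generalized solutions\<close>

text \<open>The decay factor is the same for all approximating classical solutions, and both sides of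
  their estimate are continuous in the \<open>L\<^sup>2\<close> norm, so it suffices to let the approximation improve at
  the fixed time \<open>t\<close>.\<close>

lemma generalized_system_solution_decay:
  fixes \<gamma> K :: real
  assumes gen: "L2_generalized_system_solution a p c \<phi>1 \<phi>2 w u"
    and "\<phi>1 \<in> L2" "\<phi>2 \<in> L2" and "a > 0" "\<gamma> > 0" "t > 0"
  defines "K \<equiv> (1 + \<bar>p\<bar>) * exp ((2 * \<gamma> + 2) / a)"
  assumes c: "\<And>x t. (x, t) \<in> strip \<Longrightarrow> \<bar>c x t\<bar> \<le> 1 / K"
  shows "L2_norm (\<lambda>x. w x t) \<le> K * exp (- \<gamma> * t) * (L2_norm \<phi>1 + L2_norm \<phi>2)"
proof -
  from gen obtain \<phi>1l \<phi>2l wl ul where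
    approx: "\<forall>l::nat. \<phi>1l l \<in> test_functions \<and> \<phi>2l l \<in> test_functions \<and>
               classical_solution a p c (\<phi>1l l) (\<phi>2l l) (wl l) (ul l)"
    and lim1: "(\<lambda>l. L2_norm (\<lambda>x. \<phi>1l l x - \<phi>1 x)) \<longlonglongrightarrow> 0"
    and lim2: "(\<lambda>l. L2_norm (\<lambda>x. \<phi>2l l x - \<phi>2 x)) \<longlonglongrightarrow> 0"
    and unif: "\<forall>t>0.
      uniform_limit {0..t} (\<lambda>l \<theta>. L2_norm (\<lambda>x. w x \<theta> - wl l x \<theta>)) (\<lambda>_. 0) sequentially \<and>
      uniform_limit {0..t} (\<lambda>l \<theta>. L2_norm (\<lambda>x. u x \<theta> - ul l x \<theta>)) (\<lambda>_. 0) sequentially"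
    unfolding L2_generalized_system_solution_def by (elim conjE exE) (rule that)
  have test: "\<phi>1l l \<in> test_functions" "\<phi>2l l \<in> test_functions"
    and sol: "classical_solution a p c (\<phi>1l l) (\<phi>2l l) (wl l) (ul l)" for l
    using approx by blast+
  have limw: "(\<lambda>l. L2_norm (\<lambda>x. w x t - wl l x t)) \<longlonglongrightarrow> 0"
    using tendsto_uniform_limitI[OF conjunct1[OF unif[rule_format, OF \<open>t > 0\<close>]], of t] \<open>t > 0\<close>
    by simp
  have w: "(\<lambda>x. w x t) \<in> L2"
    using gen \<open>t > 0\<close> by (simp add: L2_generalized_system_solution_def L2_continuous_def)
  have K: "0 \<le> K * exp (- \<gamma> * t)"
    by (simp add: K_def)
  have "L2_norm (\<lambda>x. w x t)
      \<le> K * exp (- \<gamma> * t) * ((L2_norm \<phi>1 + L2_norm (\<lambda>x. \<phi>1l l x - \<phi>1 x))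
                            + (L2_norm \<phi>2 + L2_norm (\<lambda>x. \<phi>2l l x - \<phi>2 x)))
        + L2_norm (\<lambda>x. w x t - wl l x t)" for l
  proof -
    have "(\<lambda>x. wl l x t) \<in> L2"
      using C1_closed_strip_slice[OF classical_solution_C1(1)[OF sol[of l]], of t] \<open>t > 0\<close>
      by (intro continuous_imp_L2(1)) simp
    then have "L2_norm (\<lambda>x. w x t)
        \<le> L2_norm (\<lambda>x. wl l x t) + L2_norm (\<lambda>x. w x t - wl l x t)"
      by (rule L2_norm_le_add_diff[OF w])
    also have "L2_norm (\<lambda>x. wl l x t)
        \<le> K * exp (- \<gamma> * t) * (L2_norm (\<phi>1l l) + L2_norm (\<phi>2l l))"
      using classical_solution_decay[OF sol[of l] \<open>a > 0\<close> \<open>\<gamma> > 0\<close>, of t] \<open>t > 0\<close> c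
      unfolding K_def by simp
    also have "\<dots> \<le> K * exp (- \<gamma> * t) * ((L2_norm \<phi>1 + L2_norm (\<lambda>x. \<phi>1l l x - \<phi>1 x))
                            + (L2_norm \<phi>2 + L2_norm (\<lambda>x. \<phi>2l l x - \<phi>2 x)))"
      by (intro mult_left_mono[OF _ K] add_mono L2_norm_le_add_diff
          test_function_L2[OF test(1)] test_function_L2[OF test(2)] assms(2,3))
    finally show ?thesis by simp
  qed
  moreover have "(\<lambda>l. K * exp (- \<gamma> * t) * ((L2_norm \<phi>1 + L2_norm (\<lambda>x. \<phi>1l l x - \<phi>1 x))
                            + (L2_norm \<phi>2 + L2_norm (\<lambda>x. \<phi>2l l x - \<phi>2 x)))
        + L2_norm (\<lambda>x. w x t - wl l x t))
      \<longlonglongrightarrow> K * exp (- \<gamma> * t) * ((L2_norm \<phi>1 + 0) + (L2_norm \<phi>2 + 0)) + 0"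
    by (intro tendsto_intros lim1 lim2 limw)
  ultimately show ?thesis
    by (intro LIMSEQ_le_const[of _ "K * exp (- \<gamma> * t) * (L2_norm \<phi>1 + L2_norm \<phi>2)"]) auto
qed

lemma weak_deriv_L2:
  assumes "f \<in> H1"
  shows "weak_deriv f \<in> L2"
proof -
  have "\<exists>g. g \<in> L2 \<and> has_weak_derivative f g"
    using assms unfolding H1_def by blast
  from someI_ex[OF this] show ?thesis
    unfolding weak_deriv_def by (rule conjunct1)
qed

lemma L2_norm_le_H1_norm: "L2_norm f \<le> H1_norm f" "L2_norm (weak_deriv f) \<le> H1_norm f"
  unfolding H1_norm_def by (rule real_le_rsqrt; simp)+

theorem theorem1p1:
  fixes a p :: real
  assumes "a > 0"
  shows "\<forall>\<gamma>>0. \<exists>\<epsilon>>0. \<exists>M::real.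
    \<forall>(c :: real \<Rightarrow> real \<Rightarrow> real) w0 w1 w.
      bounded_C2_closed_strip c \<longrightarrow>
      (SUP (x, t)\<in>strip. \<bar>c x t\<bar>) < \<epsilon> \<longrightarrow>
      w0 \<in> H1 \<longrightarrow> w1 \<in> L2 \<longrightarrow>
      L2_generalized_solution a p c w0 w1 w \<longrightarrow>
      (\<forall>t>0. L2_norm (\<lambda>x. w x t) \<le> M * exp (- \<gamma> * t) * max (H1_norm w0) (L2_norm w1))"
proof (intro allI impI)
  fix \<gamma> :: real assume "\<gamma> > 0"
  define K where "K = (1 + \<bar>p\<bar>) * exp ((2 * \<gamma> + 2) / a)"
  have "K > 0" by (simp add: K_def)
  show "\<exists>\<epsilon>>0. \<exists>M::real.
    \<forall>(c :: real \<Rightarrow> real \<Rightarrow> real) w0 w1 w.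
      bounded_C2_closed_strip c \<longrightarrow>
      (SUP (x, t)\<in>strip. \<bar>c x t\<bar>) < \<epsilon> \<longrightarrow>
      w0 \<in> H1 \<longrightarrow> w1 \<in> L2 \<longrightarrow>
      L2_generalized_solution a p c w0 w1 w \<longrightarrow>
      (\<forall>t>0. L2_norm (\<lambda>x. w x t) \<le> M * exp (- \<gamma> * t) * max (H1_norm w0) (L2_norm w1))"
    \<comment> \<open>The data of the first order system are \<open>w0\<close> and \<open>w1 + a w0'\<close>, whose norms add up to at most
      \<open>2 + a\<close> times the maximum of the norms of \<open>w0\<close> and \<open>w1\<close>.\<close>
  proof (rule exI[of _ "1 / K"], intro conjI exI[of _ "K * (2 + a)"] allI impI)
    fix c :: "real \<Rightarrow> real \<Rightarrow> real" and w0 w1 w and t :: real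
    assume bdd: "bounded_C2_closed_strip c" and sup: "(SUP (x, t)\<in>strip. \<bar>c x t\<bar>) < 1 / K"
      and w0: "w0 \<in> H1" and w1: "w1 \<in> L2"
      and gen: "L2_generalized_solution a p c w0 w1 w" and "t > 0"
    let ?\<phi> = "\<lambda>x. w1 x + a * weak_deriv w0 x" and ?m = "max (H1_norm w0) (L2_norm w1)"
    have "bounded ((\<lambda>(x, t). c x t) ` closed_strip)"
      using bdd by (simp add: bounded_C2_closed_strip_def)
    then have "bdd_above ((\<lambda>(x, t). \<bar>c x t\<bar>) ` strip)"
      by (fastforce simp: bounded_iff bdd_above_def strip_def closed_strip_def)
    then have c: "\<bar>c x t\<bar> \<le> 1 / K" if "(x, t) \<in> strip" for x t
      using cSUP_upper[OF that, of "\<lambda>(x, t). \<bar>c x t\<bar>"] sup by simp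
    have wd: "(\<lambda>x. a * weak_deriv w0 x) \<in> L2"
      using weak_deriv_L2[OF w0] by (rule L2_scale)
    obtain u where "L2_generalized_system_solution a p c w0 ?\<phi> w u"
      using gen unfolding L2_generalized_solution_def by blast
    then have "L2_norm (\<lambda>x. w x t) \<le> K * exp (- \<gamma> * t) * (L2_norm w0 + L2_norm ?\<phi>)"
      unfolding K_def using w0 \<open>a > 0\<close> \<open>\<gamma> > 0\<close> \<open>t > 0\<close> c[unfolded K_def]
      by (intro generalized_system_solution_decay L2_add[OF w1 wd]) (simp_all add: H1_def)
    also have "\<dots> \<le> K * exp (- \<gamma> * t) * (?m + (?m + a * ?m))"
    proof (intro mult_left_mono add_mono)
      show "L2_norm w0 \<le> ?m"
        using L2_norm_le_H1_norm(1)[of w0] by simp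
      have "L2_norm ?\<phi> \<le> L2_norm w1 + a * L2_norm (weak_deriv w0)"
        using L2_norm_triangle[OF w1 wd] \<open>a > 0\<close> by (simp add: L2_norm_scale)
      also have "\<dots> \<le> ?m + a * ?m"
        using L2_norm_le_H1_norm(2)[of w0] \<open>a > 0\<close>
        by (intro add_mono mult_left_mono) auto
      finally show "L2_norm ?\<phi> \<le> ?m + a * ?m" .
    qed (use \<open>K > 0\<close> in auto)
    also have "\<dots> = K * (2 + a) * exp (- \<gamma> * t) * ?m"
      by (simp add: algebra_simps)
    finally show "L2_norm (\<lambda>x. w x t) \<le> K * (2 + a) * exp (- \<gamma> * t) * ?m" .
  qed (use \<open>K > 0\<close> in simp)
qed

end
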